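(* Let $m\ge 2$ be an integer. The optimal (i.e. smallest) constant $C$ such that $$\sum_{j_1=1}^{N}\left(\sum_{j_2,\ldots,j_m=1}^{N}\left|U(e_{j_1},\ldots,e_{j_m})\right|^{2}\right)^{\frac12}\le C\,\|U\|$$ holds for all continuous real $m$-linear forms $U:c_0\times\cdots\times c_0\to\mathbb{R}$ and all positive integers $N$ is exactly $C=\left(\sqrt2\right)^{m-1}$.
   Context: $c_0$ is the real Banach space of real sequences converging to zero, endowed with the sup norm, and $(e_j)_{j\ge1}$ are its canonical unit vectors. For a continuous $m$-linear form $U:c_0\times\cdots\times c_0\to\mathbb{R}$ ($m$ factors), $\|U\|=\sup\{|U(x_1,\ldots,x_m)| : \|x_k\|\le 1 \text{ for } 1\le k\le m\}$. The displayed inequality is called the mixed $(\ell_1,\ell_2)$-Littlewood inequality. *)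

theory Defs
  imports "HOL-Analysis.Analysis"
begin

section \<open>The Banach space of real null sequences\<close>

text \<open>Coordinates are numbered from \<open>0\<close>, so the usual \<open>e\<^sub>1, e\<^sub>2, \<dots>\<close> are
  \<open>c0_unit 0, c0_unit 1, \<dots>\<close> below.\<close>

typedef c0 = "{x :: nat \<Rightarrow> real. x \<longlonglongrightarrow> 0}"
  morphisms c0_nth Abs_c0
  by (rule exI[of _ "\<lambda>_. 0"]) simp

setup_lifting type_definition_c0

lemma c0_nth_tendsto: "c0_nth x \<longlonglongrightarrow> 0"
  using c0_nth[of x] by simp

lemma c0_eqI: "(\<And>n. c0_nth x n = c0_nth y n) \<Longrightarrow> x = y"
  by (metis c0_nth_inject ext)

instantiation c0 :: real_vector
begin

lift_definition zero_c0 :: c0 is "\<lambda>_. 0" by simp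
lift_definition plus_c0 :: "c0 \<Rightarrow> c0 \<Rightarrow> c0" is "\<lambda>x y n. x n + y n"
  by (rule tendsto_add_zero)
lift_definition uminus_c0 :: "c0 \<Rightarrow> c0" is "\<lambda>x n. - x n"
  using tendsto_minus by fastforce
lift_definition minus_c0 :: "c0 \<Rightarrow> c0 \<Rightarrow> c0" is "\<lambda>x y n. x n - y n"
  using tendsto_diff by fastforce
lift_definition scaleR_c0 :: "real \<Rightarrow> c0 \<Rightarrow> c0" is "\<lambda>r x n. r * x n"
  by (rule tendsto_mult_right_zero)

instance
  by standard (transfer; simp add: algebra_simps fun_eq_iff)+

end

lemma c0_nth_simps [simp]:
  "c0_nth 0 n = 0"
  "c0_nth (x + y) n = c0_nth x n + c0_nth y n"
  "c0_nth (- x) n = - c0_nth x n"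
  "c0_nth (x - y) n = c0_nth x n - c0_nth y n"
  "c0_nth (r *\<^sub>R x) n = r * c0_nth x n"
  by (transfer; simp)+

lemma bdd_above_c0: "bdd_above (range (\<lambda>n. \<bar>c0_nth x n\<bar>))"
proof -
  have "Bseq (c0_nth x)"
    using c0_nth_tendsto convergentI convergent_imp_Bseq by blast
  then show ?thesis
    by (auto simp: Bseq_def bdd_above_def)
qed

instantiation c0 :: real_normed_vector
begin

definition norm_c0 :: "c0 \<Rightarrow> real" where
  "norm_c0 x = (SUP n. \<bar>c0_nth x n\<bar>)"

definition dist_c0 :: "c0 \<Rightarrow> c0 \<Rightarrow> real" where
  "dist_c0 x y = norm (x - y)"

definition sgn_c0 :: "c0 \<Rightarrow> c0" where
  "sgn_c0 x = inverse (norm x) *\<^sub>R x"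

definition uniformity_c0 :: "(c0 \<times> c0) filter" where
  "uniformity_c0 = (INF e\<in>{0<..}. principal {(x, y). dist x y < e})"

definition open_c0 :: "c0 set \<Rightarrow> bool" where
  "open_c0 U \<longleftrightarrow> (\<forall>x\<in>U. eventually (\<lambda>(x', y). x' = x \<longrightarrow> y \<in> U) uniformity)"

instance
proof
  fix x y :: c0 and a :: real
  have upper: "\<bar>c0_nth z n\<bar> \<le> norm z" for z :: c0 and n
    unfolding norm_c0_def by (rule cSUP_upper[OF UNIV_I bdd_above_c0])
  have least: "norm z \<le> B" if "\<And>n. \<bar>c0_nth z n\<bar> \<le> B" for z :: c0 and B
    unfolding norm_c0_def by (rule cSUP_least) (use that in auto)
  show "dist x y = norm (x - y)"
    by (rule dist_c0_def)
  show "sgn x = inverse (norm x) *\<^sub>R x"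
    by (rule sgn_c0_def)
  show "uniformity = (INF e\<in>{0<..}. principal {(x :: c0, y). dist x y < e})"
    by (rule uniformity_c0_def)
  show "open U \<longleftrightarrow> (\<forall>x\<in>U. \<forall>\<^sub>F (x', y) in uniformity. x' = x \<longrightarrow> y \<in> U)" for U :: "c0 set"
    by (rule open_c0_def)
  show "norm x = 0 \<longleftrightarrow> x = 0"
  proof
    assume "norm x = 0"
    then have "c0_nth x n = 0" for n
      using upper[of x n] by simp
    then show "x = 0"
      by (intro c0_eqI) simp
  qed (simp add: norm_c0_def)
  show "norm (x + y) \<le> norm x + norm y"
    by (rule least) (use upper[of x] upper[of y] in \<open>simp add: abs_triangle_ineq[THEN order_trans] add_mono\<close>)
  have le: "norm (b *\<^sub>R z) \<le> \<bar>b\<bar> * norm z" for b and z :: c0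
    by (rule least) (simp add: abs_mult mult_left_mono upper)
  show "norm (a *\<^sub>R x) = \<bar>a\<bar> * norm x"
  proof (cases "a = 0")
    case False
    have "\<bar>a\<bar> * norm x \<le> norm (a *\<^sub>R x)"
      using le[of "inverse a" "a *\<^sub>R x"] False by (simp add: field_simps)
    with le[of a x] show ?thesis by simp
  qed (simp add: norm_c0_def)
qed

end

lemma abs_c0_nth_le_norm: "\<bar>c0_nth x n\<bar> \<le> norm x"
  unfolding norm_c0_def by (rule cSUP_upper[OF UNIV_I bdd_above_c0])

lemma norm_c0_le: "(\<And>n. \<bar>c0_nth x n\<bar> \<le> B) \<Longrightarrow> norm x \<le> B"
  unfolding norm_c0_def by (rule cSUP_least) auto

instance c0 :: banach
proof
  fix X :: "nat \<Rightarrow> c0"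
  assume X: "Cauchy X"
  have close: "\<exists>M. \<forall>i\<ge>M. \<forall>j\<ge>M. \<forall>n. \<bar>c0_nth (X i) n - c0_nth (X j) n\<bar> < e" if "e > 0" for e
  proof -
    obtain M where M: "\<And>i j. i \<ge> M \<Longrightarrow> j \<ge> M \<Longrightarrow> norm (X i - X j) < e"
      using CauchyD[OF X \<open>e > 0\<close>] by blast
    have "\<bar>c0_nth (X i) n - c0_nth (X j) n\<bar> < e" if "i \<ge> M" "j \<ge> M" for i j n
      using abs_c0_nth_le_norm[of "X i - X j" n] M[OF that] by simp
    then show ?thesis by blast
  qed
  define l where "l n = lim (\<lambda>i. c0_nth (X i) n)" for n
  have l: "(\<lambda>i. c0_nth (X i) n) \<longlonglongrightarrow> l n" for n
  proof -
    have "Cauchy (\<lambda>i. c0_nth (X i) n)"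
      by (rule CauchyI) (use close in \<open>simp, meson\<close>)
    then show ?thesis
      unfolding l_def by (simp add: Cauchy_convergent_iff convergent_LIMSEQ_iff)
  qed
  have unif: "\<exists>M. \<forall>i\<ge>M. \<forall>n. \<bar>c0_nth (X i) n - l n\<bar> \<le> e" if "e > 0" for e
  proof -
    obtain M where M: "\<And>i j n. i \<ge> M \<Longrightarrow> j \<ge> M \<Longrightarrow> \<bar>c0_nth (X i) n - c0_nth (X j) n\<bar> < e"
      using close[OF \<open>e > 0\<close>] by blast
    have "\<bar>c0_nth (X i) n - l n\<bar> \<le> e" if "i \<ge> M" for i n
    proof (rule LIMSEQ_le_const2)
      show "(\<lambda>j. \<bar>c0_nth (X i) n - c0_nth (X j) n\<bar>) \<longlonglongrightarrow> \<bar>c0_nth (X i) n - l n\<bar>"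
        by (intro tendsto_intros l)
      show "\<exists>N. \<forall>j\<ge>N. \<bar>c0_nth (X i) n - c0_nth (X j) n\<bar> \<le> e"
        using M[OF that] less_imp_le by blast
    qed
    then show ?thesis by blast
  qed
  have "l \<longlonglongrightarrow> 0"
  proof (rule LIMSEQ_I)
    fix e :: real
    assume "e > 0"
    then obtain i where i: "\<And>n. \<bar>c0_nth (X i) n - l n\<bar> \<le> e / 2"
      using unif[of "e / 2"] by auto
    obtain K where K: "\<And>n. n \<ge> K \<Longrightarrow> \<bar>c0_nth (X i) n\<bar> < e / 2"
      using LIMSEQ_D[OF c0_nth_tendsto[of "X i"], of "e / 2"] \<open>e > 0\<close> by auto
    have "norm (l n - 0) < e" if "n \<ge> K" for n
      using i[of n] K[OF that] by (auto simp: abs_if split: if_splits)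
    then show "\<exists>K. \<forall>n\<ge>K. norm (l n - 0) < e" by blast
  qed
  then have nth: "c0_nth (Abs_c0 l) = l"
    by (simp add: Abs_c0_inverse)
  have "X \<longlonglongrightarrow> Abs_c0 l"
  proof (rule LIMSEQ_I)
    fix e :: real
    assume "e > 0"
    then obtain M where "\<And>i n. i \<ge> M \<Longrightarrow> \<bar>c0_nth (X i) n - l n\<bar> \<le> e / 2"
      using unif[of "e / 2"] by auto
    then have "norm (X i - Abs_c0 l) \<le> e / 2" if "i \<ge> M" for i
      using that by (intro norm_c0_le) (simp add: nth)
    with \<open>e > 0\<close> show "\<exists>M. \<forall>i\<ge>M. norm (X i - Abs_c0 l) < e"
      by (intro exI[of _ M]) force
  qed
  then show "convergent X"
    by (rule convergentI)
qed

lift_definition c0_unit :: "nat \<Rightarrow> c0" is "\<lambda>j n. if n = j then 1 else 0"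
  by (rule tendsto_eventually, rule eventually_mono[OF eventually_gt_at_top]) auto


section \<open>Continuous multilinear forms\<close>

text \<open>An \<open>m\<close>-tuple over \<open>'a\<close> is an extensional function in \<open>{..<m} \<rightarrow>\<^sub>E UNIV\<close>,
  so the arguments are numbered \<open>0, \<dots>, m - 1\<close>.  The values of a form outside
  this set are irrelevant.\<close>

definition multilinear_form :: "nat \<Rightarrow> ((nat \<Rightarrow> 'a::real_vector) \<Rightarrow> real) \<Rightarrow> bool" where
  "multilinear_form m U \<longleftrightarrow>
     (\<forall>x \<in> {..<m} \<rightarrow>\<^sub>E UNIV. \<forall>k<m. linear (\<lambda>y. U (x(k := y))))"

definition continuous_multilinear_form ::
    "nat \<Rightarrow> ((nat \<Rightarrow> 'a::real_normed_vector) \<Rightarrow> real) \<Rightarrow> bool" where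
  "continuous_multilinear_form m U \<longleftrightarrow>
     multilinear_form m U \<and>
     continuous_map (product_topology (\<lambda>_. euclidean) {..<m}) euclidean U"

definition form_norm :: "nat \<Rightarrow> ((nat \<Rightarrow> 'a::real_normed_vector) \<Rightarrow> real) \<Rightarrow> real" where
  "form_norm m U = (SUP x \<in> {..<m} \<rightarrow>\<^sub>E cball 0 1. \<bar>U x\<bar>)"


section \<open>The mixed Littlewood inequality\<close>

text \<open>The outer index \<open>i\<close> belongs to the first argument (number \<open>0\<close>); the
  multi-index \<open>j\<close> ranges over the indices of the remaining \<open>m - 1\<close> arguments.\<close>

definition mixed_littlewood_sum :: "nat \<Rightarrow> ((nat \<Rightarrow> c0) \<Rightarrow> real) \<Rightarrow> nat \<Rightarrow> real" where
  "mixed_littlewood_sum m U N =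
     (\<Sum>i<N. sqrt (\<Sum>j \<in> {1..<m} \<rightarrow>\<^sub>E {..<N}.
        \<bar>U (\<lambda>k\<in>{..<m}. c0_unit (if k = 0 then i else j k))\<bar>\<^sup>2))"

definition mixed_littlewood_constant :: "nat \<Rightarrow> real \<Rightarrow> bool" where
  "mixed_littlewood_constant m C \<longleftrightarrow>
     (\<forall>U N. continuous_multilinear_form m U \<longrightarrow> N \<ge> 1 \<longrightarrow>
        mixed_littlewood_sum m U N \<le> C * form_norm m U)"

end

theory Submission
  imports Defs
begin

text \<open>
  The upper bound rests on the Khinchine inequality between the first and second moments,
  with the sharp constant \<open>\<surd>2\<close> and for coefficients in a Euclidean space
  (\<open>khinchine_L2_set\<close>).  Vector coefficients let one treat one argument of \<open>U\<close> at a time: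
  with the values of the form at the other unit vectors collected in a vector, the inequality
  replaces the sum over \<open>l\<close> of the squares at \<open>e\<^sub>l\<close> in argument \<open>k\<close> by an average, over
  signs \<open>\<epsilon>\<close>, of the values at \<open>\<Sum>\<^sub>l \<epsilon>\<^sub>l e\<^sub>l\<close>, at the cost of a factor \<open>\<surd>2\<close>.  This vector lies
  in the unit ball of \<open>c\<^sub>0\<close>, so an upper bound that is uniform over the unit ball survives the
  averaging.  After all \<open>m - 1\<close> inner arguments have been treated there remains
  \<open>\<Sum>\<^sub>i \<bar>U(e\<^sub>i, x\<^sub>1, \<dots>, x\<^sub>m\<^sub>-\<^sub>1)\<bar>\<close>, which is a single value of \<open>U\<close>, at a vector of signs
  (\<open>mixed_sum_upper_bound\<close>).

  The sharp Khinchine inequality is proved by the argument of Latala and Oleszkiewicz.  The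
  norm of a sum with random signs is an even function on the discrete cube, so its Walsh
  expansion has no terms of degree \<open>1\<close> and the spectral gap for it is \<open>2\<close> rather than \<open>1\<close>
  (\<open>cube_second_spectral_gap\<close>).  On the other hand the triangle inequality bounds its energy
  by its second moment.  Together these give \<open>E f\<^sup>2 \<le> 2 (E f)\<^sup>2\<close>
  (\<open>sign_mean_power2_le_twice\<close>).

  For the lower bound let \<open>n = m - 1\<close> and let \<open>s\<close> range over all sign patterns of length \<open>n\<close>,
  used as coordinates of the first argument.  The form
  \<open>\<Sum>\<^sub>s x\<^sub>0(s) \<Prod>\<^sub>k (x\<^sub>k(0) + s\<^sub>k x\<^sub>k(1))\<close> has norm at most
  \<open>\<Prod>\<^sub>k (\<bar>x\<^sub>k(0) + x\<^sub>k(1)\<bar> + \<bar>x\<^sub>k(0) - x\<^sub>k(1)\<bar>) \<le> 2\<^sup>n\<close>, while each of the \<open>2\<^sup>n\<close> values of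
  the outer index contributes \<open>2\<^sup>n\<close> coefficients \<open>\<plusminus>1\<close>, so that the mixed sum is
  \<open>2\<^sup>n (\<surd>2)\<^sup>n\<close>.
\<close>

section \<open>Averages over signs\<close>

text \<open>The expectation over independent random signs in the first \<open>n\<close> coordinates.  The
  recursion on \<open>n\<close> is the form in which the inequalities on the cube are proved: all of them
  are obtained by splitting off the last coordinate.\<close>

primrec sign_mean :: "nat \<Rightarrow> ((nat \<Rightarrow> real) \<Rightarrow> real) \<Rightarrow> real" where
  "sign_mean 0 f = f (\<lambda>_. 0)"
| "sign_mean (Suc n) f = (sign_mean n (\<lambda>e. f (e(n := 1))) + sign_mean n (\<lambda>e. f (e(n := -1)))) / 2"

definition sign_vectors :: "nat \<Rightarrow> (nat \<Rightarrow> real) set" where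
  "sign_vectors n = {e. (\<forall>i<n. \<bar>e i\<bar> = 1) \<and> (\<forall>i\<ge>n. e i = 0)}"

lemma sign_vectors_Suc:
  assumes "e \<in> sign_vectors n" "\<bar>c\<bar> = 1"
  shows "e(n := c) \<in> sign_vectors (Suc n)"
  using assms by (auto simp: sign_vectors_def)

lemma sign_mean_mono:
  assumes "\<And>e. e \<in> sign_vectors n \<Longrightarrow> f e \<le> g e"
  shows "sign_mean n f \<le> sign_mean n g"
  using assms
proof (induction n arbitrary: f g)
  case 0
  from 0[of "\<lambda>_. 0"] show ?case by (simp add: sign_vectors_def)
next
  case (Suc n)
  have "sign_mean n (\<lambda>e. f (e(n := c))) \<le> sign_mean n (\<lambda>e. g (e(n := c)))" if "\<bar>c\<bar> = 1" for c
    by (rule Suc.IH) (use that Suc.prems sign_vectors_Suc in blast)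
  from this[of 1] this[of "-1"] show ?case by simp
qed

lemma sign_mean_cong:
  assumes "\<And>e. e \<in> sign_vectors n \<Longrightarrow> f e = g e"
  shows "sign_mean n f = sign_mean n g"
  by (intro antisym sign_mean_mono) (simp_all add: assms)

lemma sign_mean_const [simp]: "sign_mean n (\<lambda>_. c) = c"
  by (induction n) simp_all

lemma sign_mean_add: "sign_mean n (\<lambda>e. f e + g e) = sign_mean n f + sign_mean n g"
  by (induction n arbitrary: f g) (simp_all add: field_simps)

lemma sign_mean_mult: "sign_mean n (\<lambda>e. c * f e) = c * sign_mean n f"
  by (induction n arbitrary: f) (simp_all add: field_simps)

lemma sign_mean_diff: "sign_mean n (\<lambda>e. f e - g e) = sign_mean n f - sign_mean n g"
  using sign_mean_add[of n f "\<lambda>e. (-1) * g e"] sign_mean_mult[of n "-1" g] by simp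

lemma sign_mean_sum: "sign_mean n (\<lambda>e. \<Sum>i\<in>A. f i e) = (\<Sum>i\<in>A. sign_mean n (f i))"
  by (induction A rule: infinite_finite_induct) (simp_all add: sign_mean_add)

lemma sign_mean_uminus: "sign_mean n (\<lambda>e. f (\<lambda>i. - e i)) = sign_mean n f"
proof (induction n arbitrary: f)
  case (Suc n)
  have *: "(\<lambda>i. - (e(n := c)) i) = (\<lambda>i. - e i)(n := - c)" for e :: "nat \<Rightarrow> real" and c
    by (simp add: fun_eq_iff)
  show ?case
    unfolding sign_mean.simps * 
    using Suc.IH[of "\<lambda>e. f (e(n := -1))"] Suc.IH[of "\<lambda>e. f (e(n := 1))"] by simp
qed simp

lemma sign_mean_flip:
  "i < n \<Longrightarrow> sign_mean n (\<lambda>e. f (e(i := - e i))) = sign_mean n f"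
proof (induction n arbitrary: f)
  case (Suc n)
  show ?case
  proof (cases "i = n")
    case False
    then have *: "(e(n := c))(i := - (e(n := c)) i) = (e(i := - e i))(n := c)"
      for e :: "nat \<Rightarrow> real" and c by (simp add: fun_upd_twist)
    have "i < n" using Suc.prems False by simp
    then show ?thesis
      unfolding sign_mean.simps *
      using Suc.IH[of "\<lambda>e. f (e(n := -1))"] Suc.IH[of "\<lambda>e. f (e(n := 1))"] by (simp del: fun_upd_apply)
  next
    case True
    have *: "(e(n := c))(n := - (e(n := c)) n) = e(n := - c)" for e :: "nat \<Rightarrow> real" and c
      by simp
    show ?thesis
      unfolding True sign_mean.simps * by simp
  qed
qed simp

lemma sign_mean_power2_le: "(sign_mean n f)\<^sup>2 \<le> sign_mean n (\<lambda>e. (f e)\<^sup>2)"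
proof -
  \<comment> \<open>The variance is nonnegative.\<close>
  define c where "c = sign_mean n f"
  have "0 \<le> sign_mean n (\<lambda>e. (f e - c)\<^sup>2)"
    using sign_mean_mono[of n "\<lambda>_. 0" "\<lambda>e. (f e - c)\<^sup>2"] by simp
  also have "(\<lambda>e. (f e - c)\<^sup>2) = (\<lambda>e. (f e)\<^sup>2 + (c\<^sup>2 - (2 * c) * f e))"
    by (simp add: power2_eq_square algebra_simps)
  also have "sign_mean n \<dots> = sign_mean n (\<lambda>e. (f e)\<^sup>2) - c\<^sup>2"
    unfolding sign_mean_add sign_mean_diff sign_mean_mult
    by (simp add: c_def power2_eq_square algebra_simps)
  finally show ?thesis by (simp add: c_def)
qed

text \<open>Independent signs are orthonormal.\<close>

lemma sign_mean_linear_power2: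
  "sign_mean n (\<lambda>e. (\<Sum>l<n. e l * a l)\<^sup>2) = (\<Sum>l<n. (a l)\<^sup>2)"
proof (induction n)
  case (Suc n)
  have *: "(\<Sum>l<Suc n. (e(n := c)) l * a l) = (\<Sum>l<n. e l * a l) + c * a n" for e c
    by simp
  have "sign_mean (Suc n) (\<lambda>e. (\<Sum>l<Suc n. e l * a l)\<^sup>2)
      = sign_mean n (\<lambda>e. (((\<Sum>l<n. e l * a l) + 1 * a n)\<^sup>2 + ((\<Sum>l<n. e l * a l) + (-1) * a n)\<^sup>2)) / 2"
    unfolding sign_mean.simps * sign_mean_add ..
  also have "\<dots> = sign_mean n (\<lambda>e. 2 * ((\<Sum>l<n. e l * a l)\<^sup>2 + (a n)\<^sup>2)) / 2"
    by (simp add: power2_eq_square algebra_simps)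
  also have "\<dots> = (\<Sum>l<Suc n. (a l)\<^sup>2)"
    unfolding sign_mean_mult sign_mean_add Suc.IH by simp
  finally show ?case .
qed simp


section \<open>The spectral gap of the discrete cube\<close>

text \<open>The Dirichlet form of the cube.  With the factor \<open>1/4\<close>, a Walsh function of degree \<open>d\<close>
  has energy exactly \<open>d\<close>.\<close>

definition cube_energy :: "nat \<Rightarrow> ((nat \<Rightarrow> real) \<Rightarrow> real) \<Rightarrow> real" where
  "cube_energy n f = (\<Sum>i<n. sign_mean n (\<lambda>e. (f e - f (e(i := - e i)))\<^sup>2)) / 4"

text \<open>As a function of the coordinate \<open>n\<close> alone, \<open>f\<close> is affine on \<open>{-1, 1}\<close>: it is
  \<open>g + \<epsilon>\<^sub>n h\<close>, where \<open>g\<close> and \<open>h\<close> are the two parts below.  Second moment and energy are additive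
  over this decomposition, except that the energy gains a term for the factor \<open>\<epsilon>\<^sub>n\<close>.\<close>

definition even_part :: "nat \<Rightarrow> ((nat \<Rightarrow> real) \<Rightarrow> real) \<Rightarrow> (nat \<Rightarrow> real) \<Rightarrow> real" where
  "even_part n f e = (f (e(n := 1)) + f (e(n := -1))) / 2"

definition odd_part :: "nat \<Rightarrow> ((nat \<Rightarrow> real) \<Rightarrow> real) \<Rightarrow> (nat \<Rightarrow> real) \<Rightarrow> real" where
  "odd_part n f e = (f (e(n := 1)) - f (e(n := -1))) / 2"

lemma parts:
  "f (e(n := 1)) = even_part n f e + odd_part n f e"
  "f (e(n := -1)) = even_part n f e - odd_part n f e"
  by (simp_all add: even_part_def odd_part_def field_simps)

lemma sign_mean_Suc_parts: "sign_mean (Suc n) f = sign_mean n (even_part n f)"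
  by (simp add: parts sign_mean_add sign_mean_diff)

lemma sign_mean_power2_Suc_parts:
  "sign_mean (Suc n) (\<lambda>e. (f e)\<^sup>2)
   = sign_mean n (\<lambda>e. (even_part n f e)\<^sup>2) + sign_mean n (\<lambda>e. (odd_part n f e)\<^sup>2)"
  unfolding sign_mean_Suc_parts sign_mean_add[symmetric]
  by (rule sign_mean_cong) (simp add: even_part_def odd_part_def field_simps power2_eq_square)

lemma cube_energy_Suc_parts:
  "cube_energy (Suc n) f
   = cube_energy n (even_part n f) + cube_energy n (odd_part n f) + sign_mean n (\<lambda>e. (odd_part n f e)\<^sup>2)"
proof -
  have low: "sign_mean (Suc n) (\<lambda>e. (f e - f (e(i := - e i)))\<^sup>2)
      = sign_mean n (\<lambda>e. (even_part n f e - even_part n f (e(i := - e i)))\<^sup>2)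
      + sign_mean n (\<lambda>e. (odd_part n f e - odd_part n f (e(i := - e i)))\<^sup>2)" if "i < n" for i
    unfolding sign_mean_power2_Suc_parts
    by (intro arg_cong2[where f = "(+)"] sign_mean_cong arg_cong[where f = "\<lambda>t. t\<^sup>2"])
      (use that in \<open>simp_all add: even_part_def odd_part_def fun_upd_twist[of i n] field_simps\<close>)
  have top: "sign_mean (Suc n) (\<lambda>e. (f e - f (e(n := - e n)))\<^sup>2) = 4 * sign_mean n (\<lambda>e. (odd_part n f e)\<^sup>2)"
    unfolding sign_mean_mult[symmetric] sign_mean_Suc_parts
    by (rule sign_mean_cong) (simp add: even_part_def odd_part_def field_simps power2_eq_square)
  show ?thesis
    by (simp add: cube_energy_def low top sum.distrib field_simps del: sign_mean.simps)
qed

text \<open>The first spectral gap: nonconstant Walsh functions have energy at least \<open>1\<close>.\<close>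

lemma cube_poincare:
  "sign_mean n (\<lambda>e. (f e)\<^sup>2) - (sign_mean n f)\<^sup>2 \<le> cube_energy n f"
proof (induction n arbitrary: f)
  case 0
  show ?case by (simp add: cube_energy_def)
next
  case (Suc n)
  have "0 \<le> cube_energy n (odd_part n f)"
    using Suc.IH[of "odd_part n f"] sign_mean_power2_le[of n "odd_part n f"] by linarith
  then show ?case
    using Suc.IH[of "even_part n f"]
    unfolding sign_mean_Suc_parts[of n f] sign_mean_power2_Suc_parts cube_energy_Suc_parts by linarith
qed

text \<open>A Walsh function of degree at least \<open>2\<close> has energy at least \<open>2\<close>; the sum on the right
  adds the unit that is missing in degree \<open>1\<close>.  In the induction the coefficients of degree
  \<open>1\<close> are those of the even part together with the mean of the odd part, and the odd part,
  already multiplied by one sign, only has to satisfy the Poincare inequality.\<close>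

lemma cube_second_spectral_gap:
  "2 * (sign_mean n (\<lambda>e. (f e)\<^sup>2) - (sign_mean n f)\<^sup>2)
   \<le> cube_energy n f + (\<Sum>i<n. (sign_mean n (\<lambda>e. e i * f e))\<^sup>2)"
proof (induction n arbitrary: f)
  case 0
  show ?case by (simp add: cube_energy_def)
next
  case (Suc n)
  have low: "sign_mean (Suc n) (\<lambda>e. e i * f e) = sign_mean n (\<lambda>e. e i * even_part n f e)" if "i < n" for i
    unfolding sign_mean_Suc_parts
    by (rule sign_mean_cong) (use that in \<open>simp add: even_part_def field_simps\<close>)
  have top: "sign_mean (Suc n) (\<lambda>e. e n * f e) = sign_mean n (odd_part n f)"
    unfolding sign_mean_Suc_parts
    by (rule sign_mean_cong) (simp add: even_part_def odd_part_def)
  have level1: "(\<Sum>i<Suc n. (sign_mean (Suc n) (\<lambda>e. e i * f e))\<^sup>2)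
      = (\<Sum>i<n. (sign_mean n (\<lambda>e. e i * even_part n f e))\<^sup>2) + (sign_mean n (odd_part n f))\<^sup>2"
    by (simp add: low top del: sign_mean.simps)
  show ?case
    using Suc.IH[of "even_part n f"] cube_poincare[of n "odd_part n f"]
    unfolding level1 sign_mean_Suc_parts[of n f] sign_mean_power2_Suc_parts cube_energy_Suc_parts
    by (smt (verit))
qed


section \<open>Khinchine's inequality with the sharp constant\<close>

text \<open>The third hypothesis says that the Laplacian of \<open>f\<close>, the sum over \<open>i\<close> of half the
  difference between \<open>f\<close> and its flip in coordinate \<open>i\<close>, is at most \<open>f\<close>.  Hence the energy
  is at most \<open>E f\<^sup>2\<close>, whereas the second spectral gap bounds it from below by
  \<open>2 (E f\<^sup>2 - (E f)\<^sup>2)\<close>, evenness removing the part of degree \<open>1\<close>.\<close>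

lemma sign_mean_power2_le_twice:
  assumes nonneg: "\<And>e. 0 \<le> f e"
    and even: "\<And>e. f (\<lambda>i. - e i) = f e"
    and flip: "\<And>e. e \<in> sign_vectors n \<Longrightarrow> (real n - 2) * f e \<le> (\<Sum>i<n. f (e(i := - e i)))"
  shows "sign_mean n (\<lambda>e. (f e)\<^sup>2) \<le> 2 * (sign_mean n f)\<^sup>2"
proof -
  have level1: "sign_mean n (\<lambda>e. e i * f e) = 0" for i
    using sign_mean_uminus[of n "\<lambda>e. e i * f e"] sign_mean_mult[of n "-1" "\<lambda>e. e i * f e"]
    by (simp add: even)
  have "(\<Sum>i<n. sign_mean n (\<lambda>e. (f e - f (e(i := - e i)))\<^sup>2))
      = (\<Sum>i<n. 2 * (sign_mean n (\<lambda>e. (f e)\<^sup>2) - sign_mean n (\<lambda>e. f e * f (e(i := - e i)))))"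
  proof (rule sum.cong)
    fix i assume i: "i \<in> {..<n}"
    have *: "(\<lambda>e. (f e - f (e(i := - e i)))\<^sup>2)
        = (\<lambda>e. ((f e)\<^sup>2 + (f (e(i := - e i)))\<^sup>2) - 2 * (f e * f (e(i := - e i))))"
      by (simp add: power2_eq_square algebra_simps)
    show "sign_mean n (\<lambda>e. (f e - f (e(i := - e i)))\<^sup>2)
        = 2 * (sign_mean n (\<lambda>e. (f e)\<^sup>2) - sign_mean n (\<lambda>e. f e * f (e(i := - e i))))"
      unfolding * sign_mean_diff sign_mean_add sign_mean_mult
      using sign_mean_flip[of i n "\<lambda>e. (f e)\<^sup>2"] i by simp
  qed simp
  also have "\<dots> = 2 * sign_mean n (\<lambda>e. real n * (f e)\<^sup>2 - (\<Sum>i<n. f e * f (e(i := - e i))))"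
    unfolding sign_mean_diff sign_mean_mult sign_mean_sum
    by (simp add: sum_distrib_left[symmetric] sum_subtractf)
  also have "\<dots> \<le> 2 * sign_mean n (\<lambda>e. 2 * (f e)\<^sup>2)"
  proof (intro mult_left_mono sign_mean_mono)
    fix e assume "e \<in> sign_vectors n"
    from mult_left_mono[OF flip[OF this] nonneg[of e]]
    show "real n * (f e)\<^sup>2 - (\<Sum>i<n. f e * f (e(i := - e i))) \<le> 2 * (f e)\<^sup>2"
      by (simp add: sum_distrib_left power2_eq_square algebra_simps)
  qed simp
  finally have "cube_energy n f \<le> sign_mean n (\<lambda>e. (f e)\<^sup>2)"
    by (simp add: cube_energy_def sign_mean_mult)
  then show ?thesis
    using cube_second_spectral_gap[of n f] by (simp add: level1)
qed

lemma L2_set_sum_le: "L2_set (\<lambda>j. \<Sum>i\<in>A. f i j) J \<le> (\<Sum>i\<in>A. L2_set (f i) J)"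
proof (induction A rule: infinite_finite_induct)
  case (insert a A)
  have "L2_set (\<lambda>j. f a j + (\<Sum>i\<in>A. f i j)) J \<le> L2_set (f a) J + L2_set (\<lambda>j. \<Sum>i\<in>A. f i j) J"
    by (rule L2_set_triangle_ineq)
  with insert show ?case by simp
qed (simp_all add: L2_set_def)

lemma L2_set_abs_mult: "L2_set (\<lambda>j. c * f j) J = \<bar>c\<bar> * L2_set f J"
  by (simp add: L2_set_def power_mult_distrib sum_distrib_left[symmetric] real_sqrt_mult)

text \<open>For the sum \<open>S\<close> of the vectors \<open>\<epsilon>\<^sub>l v\<^sub>l\<close>, flipping the sign \<open>\<epsilon>\<^sub>i\<close> gives
  \<open>S - 2 \<epsilon>\<^sub>i v\<^sub>i\<close>.  These \<open>n\<close> vectors add up to \<open>(n - 2) S\<close>, so the triangle inequality bounds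
  the sum of their norms from below as required.\<close>

theorem khinchine_L2_set:
  fixes v :: "nat \<Rightarrow> 'j \<Rightarrow> real"
  shows "sqrt (\<Sum>l<n. \<Sum>j\<in>J. (v l j)\<^sup>2)
    \<le> sqrt 2 * sign_mean n (\<lambda>e. L2_set (\<lambda>j. \<Sum>l<n. e l * v l j) J)"
proof -
  define f where "f e = L2_set (\<lambda>j. \<Sum>l<n. e l * v l j) J" for e
  have "sign_mean n (\<lambda>e. (f e)\<^sup>2) \<le> 2 * (sign_mean n f)\<^sup>2"
  proof (rule sign_mean_power2_le_twice)
    show "0 \<le> f e" for e by (simp add: f_def)
    show "f (\<lambda>i. - e i) = f e" for e
      using L2_set_abs_mult[of "-1"] by (simp add: f_def sum_negf)
    fix e :: "nat \<Rightarrow> real"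
    have "(\<Sum>i<n. \<Sum>l<n. (e(i := - e i)) l * v l j) = (real n - 2) * (\<Sum>l<n. e l * v l j)" for j
    proof -
      have "(\<Sum>l<n. (e(i := - e i)) l * v l j) = (\<Sum>l<n. e l * v l j) - 2 * (e i * v i j)" if "i < n" for i
      proof -
        have "(\<Sum>l<n. (e(i := - e i)) l * v l j) = (\<Sum>l<n. e l * v l j - (if l = i then 2 * (e i * v i j) else 0))"
          by (rule sum.cong) auto
        then show ?thesis
          using that by (simp add: sum_subtractf sum.delta)
      qed
      then have "(\<Sum>i<n. \<Sum>l<n. (e(i := - e i)) l * v l j) = (\<Sum>i<n. (\<Sum>l<n. e l * v l j) - 2 * (e i * v i j))"
        by (intro sum.cong) simp_all
      also have "\<dots> = real n * (\<Sum>l<n. e l * v l j) - 2 * (\<Sum>l<n. e l * v l j)"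
        by (simp add: sum_subtractf sum_distrib_left)
      finally show ?thesis
        by (simp add: algebra_simps)
    qed
    then have "(real n - 2) * f e \<le> L2_set (\<lambda>j. \<Sum>i<n. \<Sum>l<n. (e(i := - e i)) l * v l j) J"
      by (simp add: L2_set_abs_mult f_def mult_right_mono del: fun_upd_apply)
    also have "\<dots> \<le> (\<Sum>i<n. f (e(i := - e i)))"
      unfolding f_def by (rule L2_set_sum_le)
    finally show "(real n - 2) * f e \<le> (\<Sum>i<n. f (e(i := - e i)))" .
  qed
  also have "sign_mean n (\<lambda>e. (f e)\<^sup>2) = (\<Sum>j\<in>J. \<Sum>l<n. (v l j)\<^sup>2)"
    by (simp add: f_def L2_set_def sum_nonneg sign_mean_sum sign_mean_linear_power2)
  also have "\<dots> = (\<Sum>l<n. \<Sum>j\<in>J. (v l j)\<^sup>2)"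
    by (rule sum.swap)
  finally have "sqrt (\<Sum>l<n. \<Sum>j\<in>J. (v l j)\<^sup>2) \<le> sqrt (2 * (sign_mean n f)\<^sup>2)"
    by (rule real_sqrt_le_mono)
  moreover have "0 \<le> sign_mean n f"
    using sign_mean_mono[of n "\<lambda>_. 0" f] by (simp add: f_def)
  ultimately show ?thesis
    by (simp add: real_sqrt_mult f_def[abs_def])
qed


section \<open>Bounded multilinear forms\<close>

lemma multilinear_form_linear:
  assumes "multilinear_form m U" "x \<in> {..<m} \<rightarrow>\<^sub>E UNIV" "k < m"
  shows "linear (\<lambda>y. U (x(k := y)))"
  using assms by (simp add: multilinear_form_def)

lemma multilinear_form_scale:
  assumes U: "multilinear_form m U" and x: "x \<in> {..<m} \<rightarrow>\<^sub>E UNIV"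
  shows "U (\<lambda>k\<in>{..<m}. r *\<^sub>R x k) = r ^ m * U x"
proof -
  define p where "p n = (\<lambda>k\<in>{..<m}. if k < n then r *\<^sub>R x k else x k)" for n
  have "n \<le> m \<Longrightarrow> U (p n) = r ^ n * U x" for n
  proof (induction n)
    case 0
    have "p 0 = x" using x by (auto simp: p_def fun_eq_iff)
    then show ?case by simp
  next
    case (Suc n)
    have "p (Suc n) = (p n)(n := r *\<^sub>R x n)" "(p n)(n := x n) = p n"
      using Suc.prems by (auto simp: p_def fun_eq_iff)
    moreover have "linear (\<lambda>y. U ((p n)(n := y)))"
      by (rule multilinear_form_linear[OF U]) (use Suc.prems in \<open>auto simp: p_def\<close>)
    ultimately have "U (p (Suc n)) = r * U (p n)"
      using linear_scale[of "\<lambda>y. U ((p n)(n := y))" r "x n"] by simp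
    with Suc show ?case by simp
  qed
  from this[of m] have "U (p m) = r ^ m * U x" by simp
  moreover have "p m = (\<lambda>k\<in>{..<m}. r *\<^sub>R x k)"
    by (auto simp: p_def fun_eq_iff)
  ultimately show ?thesis by simp
qed

text \<open>Continuity at \<open>0\<close> bounds the form on a small polydisc, and homogeneity of degree \<open>m\<close>
  carries the bound over to the unit ball.  Thus the supremum that defines the norm is a genuine
  one.\<close>

lemma continuous_multilinear_form_bounded:
  assumes "continuous_multilinear_form m U"
  shows "bdd_above ((\<lambda>x. \<bar>U x\<bar>) ` ({..<m} \<rightarrow>\<^sub>E cball 0 1))"
proof -
  have U: "multilinear_form m U"
    and cont: "continuous_map (product_topology (\<lambda>_. euclidean) {..<m}) euclidean U"
    using assms by (auto simp: continuous_multilinear_form_def)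
  define z :: "nat \<Rightarrow> 'a" where "z = (\<lambda>k\<in>{..<m}. 0)"
  define V where "V = {x \<in> topspace (product_topology (\<lambda>_. euclidean) {..<m}). U x \<in> ball (U z) 1}"
  have "openin (product_topology (\<lambda>_. euclidean) {..<m}) V"
    unfolding V_def by (rule openin_continuous_map_preimage[OF cont]) simp
  moreover have "z \<in> V"
    by (auto simp: V_def z_def)
  ultimately obtain W where W: "\<And>k. k < m \<Longrightarrow> open (W k)" "z \<in> Pi\<^sub>E {..<m} W" "Pi\<^sub>E {..<m} W \<subseteq> V"
    unfolding openin_product_topology_alt by (metis lessThan_iff open_openin)
  have "\<exists>d>0. ball 0 d \<subseteq> W k" if "k < m" for k
    using W(1)[OF that] W(2) that by (auto simp: open_contains_ball z_def PiE_iff)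
  then obtain d where d: "\<And>k. k < m \<Longrightarrow> 0 < d k" "\<And>k. k < m \<Longrightarrow> ball 0 (d k) \<subseteq> W k"
    by metis
  define r where "r = Min (insert 1 (d ` {..<m})) / 2"
  have r: "0 < r" using d(1) by (simp add: r_def)
  have rd: "r < d k" if "k < m" for k
  proof -
    have "2 * r \<le> d k" using that by (simp add: r_def)
    with r show ?thesis by simp
  qed
  show ?thesis
  proof (rule bdd_aboveI2)
    fix x :: "nat \<Rightarrow> 'a" assume x: "x \<in> {..<m} \<rightarrow>\<^sub>E cball 0 1"
    have "(\<lambda>k\<in>{..<m}. r *\<^sub>R x k) \<in> Pi\<^sub>E {..<m} W"
    proof (rule restrict_PiE_iff[THEN iffD2], rule ballI)
      fix k assume k: "k \<in> {..<m}"
      then have "norm (x k) \<le> 1"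
        using x by (auto simp: PiE_iff)
      then have "norm (r *\<^sub>R x k) \<le> r"
        using r by (simp add: mult_left_le)
      then show "r *\<^sub>R x k \<in> W k"
        using d(2)[of k] rd[of k] k by auto
    qed
    then have "(\<lambda>k\<in>{..<m}. r *\<^sub>R x k) \<in> V"
      using W(3) by blast
    then have "U (\<lambda>k\<in>{..<m}. r *\<^sub>R x k) \<in> ball (U z) 1"
      by (simp add: V_def)
    then have "\<bar>r ^ m * U x\<bar> \<le> \<bar>U z\<bar> + 1"
      using multilinear_form_scale[OF U, of x r] x by (auto simp: dist_real_def PiE_iff)
    then show "\<bar>U x\<bar> \<le> (\<bar>U z\<bar> + 1) / r ^ m"
      using r by (simp add: abs_mult field_simps)
  qed
qed

lemma abs_le_form_norm:
  assumes "continuous_multilinear_form m U" "x \<in> {..<m} \<rightarrow>\<^sub>E cball 0 1"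
  shows "\<bar>U x\<bar> \<le> form_norm m U"
  unfolding form_norm_def
  by (rule cSUP_upper[OF assms(2) continuous_multilinear_form_bounded[OF assms(1)]])


section \<open>The upper bound\<close>

definition sign_sum :: "nat \<Rightarrow> (nat \<Rightarrow> real) \<Rightarrow> c0" where
  "sign_sum N e = (\<Sum>l<N. e l *\<^sub>R c0_unit l)"

lemma c0_nth_unit: "c0_nth (c0_unit j) n = (if n = j then 1 else 0)"
  by transfer simp

lemma c0_nth_sum: "c0_nth (\<Sum>l\<in>A. f l) n = (\<Sum>l\<in>A. c0_nth (f l) n)"
  by (induction A rule: infinite_finite_induct) simp_all

lemma norm_sign_sum_le:
  assumes "\<And>l. l < N \<Longrightarrow> \<bar>e l\<bar> \<le> 1"
  shows "norm (sign_sum N e) \<le> 1"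
proof (rule norm_c0_le)
  fix n
  have "c0_nth (sign_sum N e) n = (\<Sum>l<N. if n = l then e l else 0)"
    unfolding sign_sum_def c0_nth_sum by (rule sum.cong) (auto simp: c0_nth_unit)
  then show "\<bar>c0_nth (sign_sum N e) n\<bar> \<le> 1"
    using assms[of n] by simp
qed

lemma multilinear_form_sign_sum:
  assumes "multilinear_form m U" "x \<in> {..<m} \<rightarrow>\<^sub>E UNIV" "k < m"
  shows "U (x(k := sign_sum N e)) = (\<Sum>l<N. e l * U (x(k := c0_unit l)))"
proof -
  have lin: "linear (\<lambda>y. U (x(k := y)))"
    by (rule multilinear_form_linear[OF assms])
  show ?thesis
    unfolding sign_sum_def
    by (simp add: linear_sum[OF lin] linear_scale[OF lin] del: fun_upd_apply)
qed

text \<open>The arguments at an intermediate stage: those in \<open>K\<close> are still unit vectors, the others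
  have already been replaced by the points \<open>x k\<close> of the unit ball.\<close>

definition unit_tuple :: "nat \<Rightarrow> (nat \<Rightarrow> c0) \<Rightarrow> nat set \<Rightarrow> nat \<Rightarrow> (nat \<Rightarrow> nat) \<Rightarrow> nat \<Rightarrow> c0" where
  "unit_tuple m x K i j =
     (\<lambda>k\<in>{..<m}. if k = 0 then c0_unit i else if k \<in> K then c0_unit (j k) else x k)"

lemma sum_PiE_insert:
  assumes "k \<notin> K"
  shows "(\<Sum>j\<in>insert k K \<rightarrow>\<^sub>E S. g j) = (\<Sum>l\<in>S. \<Sum>j\<in>K \<rightarrow>\<^sub>E S. g (j(k := l)))"
  unfolding PiE_insert_eq
  by (subst sum.reindex[OF inj_combinator[OF assms]]) (simp add: sum.cartesian_product case_prod_unfold)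

text \<open>The bound is uniform in the point \<open>x\<close>, which makes the induction on \<open>K\<close> work: Khinchine's
  inequality replaces the unit vectors in argument \<open>k\<close> by a random vector of signs, and for each
  choice of the signs this is just another value of \<open>x k\<close>.\<close>

lemma mixed_sum_upper_bound:
  assumes U: "multilinear_form m U" and B: "\<And>x. x \<in> {..<m} \<rightarrow>\<^sub>E cball 0 1 \<Longrightarrow> \<bar>U x\<bar> \<le> B"
    and "0 < m" "finite K" "K \<subseteq> {1..<m}" "x \<in> {..<m} \<rightarrow>\<^sub>E cball 0 1"
  shows "(\<Sum>i<N. L2_set (\<lambda>j. U (unit_tuple m x K i j)) (K \<rightarrow>\<^sub>E {..<N})) \<le> sqrt 2 ^ card K * B"
  using assms(4-6)
proof (induction K arbitrary: x rule: finite_induct)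
  case empty
  \<comment> \<open>These signs turn the sum of absolute values into one value of the form.\<close>
  define e where "e i = sgn (U (x(0 := c0_unit i)))" for i
  have "unit_tuple m x {} i j = x(0 := c0_unit i)" for i j
    using empty.prems \<open>0 < m\<close> by (auto simp: unit_tuple_def fun_eq_iff PiE_iff extensional_def)
  then have "(\<Sum>i<N. L2_set (\<lambda>j. U (unit_tuple m x {} i j)) ({} \<rightarrow>\<^sub>E {..<N}))
      = (\<Sum>i<N. e i * U (x(0 := c0_unit i)))"
    by (simp add: L2_set_def e_def mult.commute[of "sgn _"] mult_sgn_abs abs_sgn del: fun_upd_apply)
  also have "\<dots> = U (x(0 := sign_sum N e))"
    using empty.prems \<open>0 < m\<close> by (intro multilinear_form_sign_sum[OF U, symmetric]) auto
  also have "\<dots> \<le> B"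
  proof -
    have "norm (sign_sum N e) \<le> 1"
      by (rule norm_sign_sum_le) (simp add: e_def abs_sgn_eq)
    then have "x(0 := sign_sum N e) \<in> {..<m} \<rightarrow>\<^sub>E cball 0 1"
      using empty.prems \<open>0 < m\<close> by (auto simp: PiE_iff extensional_def)
    from B[OF this] show ?thesis by simp
  qed
  finally show ?case by simp
next
  case (insert k K)
  have k: "k \<noteq> 0" "k < m" and K: "K \<subseteq> {1..<m}"
    using insert.prems by auto
  have upd: "unit_tuple m x (insert k K) i (j(k := l)) = (unit_tuple m x K i j)(k := c0_unit l)" for i j l
    using k insert.hyps by (auto simp: unit_tuple_def fun_eq_iff)
  have upd': "(unit_tuple m x K i j)(k := y) = unit_tuple m (x(k := y)) K i j" for i j y
    using k insert.hyps by (auto simp: unit_tuple_def fun_eq_iff)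
  have "L2_set (\<lambda>j. U (unit_tuple m x (insert k K) i j)) (insert k K \<rightarrow>\<^sub>E {..<N})
      \<le> sqrt 2 * sign_mean N (\<lambda>e. L2_set (\<lambda>j. U (unit_tuple m (x(k := sign_sum N e)) K i j)) (K \<rightarrow>\<^sub>E {..<N}))" for i
  proof -
    have "U (unit_tuple m (x(k := sign_sum N e)) K i j) = (\<Sum>l<N. e l * U ((unit_tuple m x K i j)(k := c0_unit l)))" for e j
      unfolding upd'[symmetric]
      by (rule multilinear_form_sign_sum[OF U]) (use k in \<open>auto simp: unit_tuple_def\<close>)
    then show ?thesis
      using khinchine_L2_set[where n = N and J = "K \<rightarrow>\<^sub>E {..<N}" and v = "\<lambda>l j. U ((unit_tuple m x K i j)(k := c0_unit l))"]
      by (simp add: L2_set_def sum_PiE_insert[OF insert.hyps(2)] upd del: fun_upd_apply)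
  qed
  then have "(\<Sum>i<N. L2_set (\<lambda>j. U (unit_tuple m x (insert k K) i j)) (insert k K \<rightarrow>\<^sub>E {..<N}))
      \<le> (\<Sum>i<N. sqrt 2 * sign_mean N (\<lambda>e. L2_set (\<lambda>j. U (unit_tuple m (x(k := sign_sum N e)) K i j)) (K \<rightarrow>\<^sub>E {..<N})))"
    by (intro sum_mono)
  also have "\<dots> = sqrt 2 * sign_mean N (\<lambda>e. \<Sum>i<N. L2_set (\<lambda>j. U (unit_tuple m (x(k := sign_sum N e)) K i j)) (K \<rightarrow>\<^sub>E {..<N}))"
    by (simp add: sign_mean_sum sum_distrib_left)
  also have "\<dots> \<le> sqrt 2 * sign_mean N (\<lambda>e. sqrt 2 ^ card K * B)"
  proof (intro mult_left_mono sign_mean_mono)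
    fix e assume "e \<in> sign_vectors N"
    then have "norm (sign_sum N e) \<le> 1"
      by (intro norm_sign_sum_le) (simp add: sign_vectors_def)
    then have "x(k := sign_sum N e) \<in> {..<m} \<rightarrow>\<^sub>E cball 0 1"
      using insert.prems k by (auto simp: PiE_iff extensional_def)
    then show "(\<Sum>i<N. L2_set (\<lambda>j. U (unit_tuple m (x(k := sign_sum N e)) K i j)) (K \<rightarrow>\<^sub>E {..<N}))
        \<le> sqrt 2 ^ card K * B"
      by (rule insert.IH[OF K])
  qed simp
  also have "\<dots> = sqrt 2 ^ card (insert k K) * B"
    using insert.hyps by simp
  finally show ?case .
qed

lemma mixed_littlewood_upper:
  assumes "0 < m"
  shows "mixed_littlewood_constant m (sqrt 2 ^ (m - 1))"
  unfolding mixed_littlewood_constant_def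
proof (intro allI impI)
  fix U :: "(nat \<Rightarrow> c0) \<Rightarrow> real" and N assume U: "continuous_multilinear_form m U"
  have "unit_tuple m (\<lambda>k\<in>{..<m}. 0) {1..<m} i j = (\<lambda>k\<in>{..<m}. c0_unit (if k = 0 then i else j k))" for i j
    by (auto simp: unit_tuple_def fun_eq_iff)
  moreover have "(\<Sum>i<N. L2_set (\<lambda>j. U (unit_tuple m (\<lambda>k\<in>{..<m}. 0) {1..<m} i j)) ({1..<m} \<rightarrow>\<^sub>E {..<N}))
      \<le> sqrt 2 ^ card {1..<m} * form_norm m U"
    using U assms
    by (intro mixed_sum_upper_bound abs_le_form_norm) (auto simp: continuous_multilinear_form_def split: if_splits)
  ultimately show "mixed_littlewood_sum m U N \<le> sqrt 2 ^ (m - 1) * form_norm m U"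
    by (simp add: mixed_littlewood_sum_def L2_set_def)
qed


section \<open>The extremal form\<close>

text \<open>Here \<open>h\<close> is meant to enumerate all sign patterns on \<open>{1..<m}\<close>, so that the coordinates of the
  first argument are indexed by sign patterns.  For \<open>m = 2\<close> this is, up to the order of the
  patterns, Littlewood's form \<open>x\<^sub>0y\<^sub>0 + x\<^sub>0y\<^sub>1 + x\<^sub>1y\<^sub>0 - x\<^sub>1y\<^sub>1\<close>.\<close>

definition extremal_form :: "nat \<Rightarrow> (nat \<Rightarrow> nat \<Rightarrow> real) \<Rightarrow> (nat \<Rightarrow> c0) \<Rightarrow> real" where
  "extremal_form m h x =
     (\<Sum>s<2 ^ (m - 1). c0_nth (x 0) s * (\<Prod>k\<in>{1..<m}. c0_nth (x k) 0 + h s k * c0_nth (x k) 1))"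

lemma continuous_map_c0_nth: "continuous_map euclidean euclideanreal (\<lambda>x. c0_nth x n)"
proof -
  have "bounded_linear (\<lambda>x. c0_nth x n)"
    by (rule bounded_linear_intro[where K = 1]) (simp_all add: abs_c0_nth_le_norm)
  then show ?thesis
    by (simp add: linear_continuous_on)
qed

lemma continuous_multilinear_extremal_form:
  assumes "0 < m"
  shows "continuous_multilinear_form m (extremal_form m h)"
  unfolding continuous_multilinear_form_def multilinear_form_def
proof (intro conjI ballI allI impI)
  fix x :: "nat \<Rightarrow> c0" and k assume k: "k < m"
  show "linear (\<lambda>y. extremal_form m h (x(k := y)))"
  proof (cases "k = 0")
    case True
    then have "extremal_form m h (x(k := y)) =
       (\<Sum>s<2 ^ (m - 1). c0_nth y s * (\<Prod>k\<in>{1..<m}. c0_nth (x k) 0 + h s k * c0_nth (x k) 1))" for y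
      unfolding extremal_form_def by (intro sum.cong prod.cong arg_cong2[where f = "(*)"]) auto
    then show ?thesis
      by (intro linearI) (simp_all add: algebra_simps sum.distrib sum_distrib_left)
  next
    case False
    have "(\<Prod>i\<in>{1..<m}. c0_nth ((x(k := y)) i) 0 + h s i * c0_nth ((x(k := y)) i) 1)
        = (c0_nth y 0 + h s k * c0_nth y 1) * (\<Prod>i\<in>{1..<m}-{k}. c0_nth (x i) 0 + h s i * c0_nth (x i) 1)" for y s
      using False k by (subst prod.remove[of _ k]) (auto intro!: prod.cong)
    then have "extremal_form m h (x(k := y)) =
       (\<Sum>s<2 ^ (m - 1). c0_nth (x 0) s * ((c0_nth y 0 + h s k * c0_nth y 1) *
          (\<Prod>i\<in>{1..<m}-{k}. c0_nth (x i) 0 + h s i * c0_nth (x i) 1)))" for y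
      using False by (simp add: extremal_form_def)
    then show ?thesis
      by (intro linearI) (simp_all add: algebra_simps sum.distrib sum_distrib_left)
  qed
next
  have coord: "continuous_map (product_topology (\<lambda>_. euclidean) {..<m}) euclideanreal (\<lambda>x. c0_nth (x k) n)"
    if "k < m" for k n
    using continuous_map_compose[OF continuous_map_product_projection[where k = k and I = "{..<m}" and X = "\<lambda>_. euclidean"]
        continuous_map_c0_nth[of n]] that
    by (simp add: o_def)
  show "continuous_map (product_topology (\<lambda>_. euclidean) {..<m}) euclideanreal (extremal_form m h)"
    unfolding extremal_form_def[abs_def]
    by (intro continuous_map_sum continuous_map_real_mult continuous_map_prod continuous_map_add
        continuous_map_real_mult_left coord) (use assms in auto)
qed

text \<open>Since all sign patterns occur, the sum of the absolute values of the products factorizes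
  into \<open>\<bar>a + b\<bar> + \<bar>a - b\<bar> = 2 max \<bar>a\<bar> \<bar>b\<bar>\<close> for the two relevant coordinates \<open>a\<close>, \<open>b\<close> of each
  argument.\<close>

lemma form_norm_extremal_form_le:
  assumes "0 < m" and h: "bij_betw h {..<2 ^ (m - 1)} ({1..<m} \<rightarrow>\<^sub>E {-1, 1})"
  shows "form_norm m (extremal_form m h) \<le> 2 ^ (m - 1)"
  unfolding form_norm_def
proof (rule cSUP_least)
  show "{..<m} \<rightarrow>\<^sub>E cball 0 1 \<noteq> ({} :: (nat \<Rightarrow> c0) set)"
    by (auto simp: PiE_eq_empty_iff)
  fix x :: "nat \<Rightarrow> c0" assume x: "x \<in> {..<m} \<rightarrow>\<^sub>E cball 0 1"
  have coord: "\<bar>c0_nth (x k) n\<bar> \<le> 1" if "k < m" for k n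
  proof -
    have "x k \<in> cball 0 1"
      using PiE_mem[OF x, of k] that by simp
    then show ?thesis
      using abs_c0_nth_le_norm[of "x k" n] by simp
  qed
  define g where "g t = (\<Prod>k\<in>{1..<m}. \<bar>c0_nth (x k) 0 + t k * c0_nth (x k) 1\<bar>)" for t
  have "\<bar>extremal_form m h x\<bar> \<le> (\<Sum>s<2 ^ (m - 1). g (h s))"
    unfolding extremal_form_def
  proof (rule order_trans[OF sum_abs sum_mono])
    fix s
    have "0 \<le> g (h s)" by (simp add: g_def prod_nonneg)
    then show "\<bar>c0_nth (x 0) s * (\<Prod>k\<in>{1..<m}. c0_nth (x k) 0 + h s k * c0_nth (x k) 1)\<bar> \<le> g (h s)"
      using mult_right_mono[OF coord[OF \<open>0 < m\<close>], of "g (h s)" s] by (simp add: abs_mult g_def abs_prod)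
  qed
  also have "\<dots> = (\<Sum>t\<in>{1..<m} \<rightarrow>\<^sub>E {-1, 1}. g t)"
    by (rule sum.reindex_bij_betw[OF h])
  also have "\<dots> = (\<Prod>k\<in>{1..<m}. \<Sum>c\<in>{-1, 1}. \<bar>c0_nth (x k) 0 + c * c0_nth (x k) 1\<bar>)"
    unfolding g_def by (subst prod_sum_PiE) auto
  also have "\<dots> \<le> (\<Prod>k\<in>{1..<m}. 2)"
  proof (rule prod_mono)
    fix k assume "k \<in> {1..<m}"
    then show "0 \<le> (\<Sum>c\<in>{-1, 1}. \<bar>c0_nth (x k) 0 + c * c0_nth (x k) 1\<bar>) \<and>
        (\<Sum>c\<in>{-1, 1}. \<bar>c0_nth (x k) 0 + c * c0_nth (x k) 1\<bar>) \<le> 2"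
      using coord[of k 0] coord[of k 1] by (auto simp: abs_le_iff abs_if)
  qed
  finally show "\<bar>extremal_form m h x\<bar> \<le> 2 ^ (m - 1)" by simp
qed

text \<open>For every outer index the coefficients are \<open>\<plusminus>1\<close> at the \<open>2 ^ (m - 1)\<close> inner multi-indices
  with entries in \<open>{0, 1}\<close>, and \<open>0\<close> elsewhere.  All of them are within range because
  \<open>m \<ge> 2\<close> makes \<open>2 ^ (m - 1)\<close> at least \<open>2\<close>.\<close>

lemma mixed_littlewood_sum_extremal_form:
  assumes "2 \<le> m" and h: "\<And>s k. s < 2 ^ (m - 1) \<Longrightarrow> k \<in> {1..<m} \<Longrightarrow> (h s k)\<^sup>2 = 1"
  shows "mixed_littlewood_sum m (extremal_form m h) (2 ^ (m - 1)) = 2 ^ (m - 1) * sqrt 2 ^ (m - 1)"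
proof -
  define N :: nat where "N = 2 ^ (m - 1)"
  have N: "2 \<le> N"
    using assms(1) self_le_power[of "2::nat" "m - 1"] by (simp add: N_def)
  have "(\<Sum>j\<in>{1..<m} \<rightarrow>\<^sub>E {..<N}. \<bar>extremal_form m h (\<lambda>k\<in>{..<m}. c0_unit (if k = 0 then i else j k))\<bar>\<^sup>2) = 2 ^ (m - 1)"
    if i: "i < N" for i
  proof -
    \<comment> \<open>The factor of argument \<open>k\<close> at the unit vector \<open>l\<close>, for the outer index \<open>i\<close>.\<close>
    define c where "c k l = (if l = 0 then 1 else if l = 1 then h i k else 0)" for k l :: nat
    have "extremal_form m h (\<lambda>k\<in>{..<m}. c0_unit (if k = 0 then i else j k)) = (\<Prod>k\<in>{1..<m}. c k (j k))" for j
    proof -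
      have "extremal_form m h (\<lambda>k\<in>{..<m}. c0_unit (if k = 0 then i else j k))
          = (\<Sum>s<N. if s = i then \<Prod>k\<in>{1..<m}. c k (j k) else 0)"
        unfolding extremal_form_def N_def[symmetric]
        by (rule sum.cong) (use assms(1) in \<open>auto simp: c0_nth_unit c_def intro!: prod.cong\<close>)
      then show ?thesis using i by simp
    qed
    then have "(\<Sum>j\<in>{1..<m} \<rightarrow>\<^sub>E {..<N}. \<bar>extremal_form m h (\<lambda>k\<in>{..<m}. c0_unit (if k = 0 then i else j k))\<bar>\<^sup>2)
        = (\<Sum>j\<in>{1..<m} \<rightarrow>\<^sub>E {..<N}. \<Prod>k\<in>{1..<m}. (c k (j k))\<^sup>2)"
      by (simp add: prod_power_distrib)
    also have "\<dots> = (\<Prod>k\<in>{1..<m}. \<Sum>l<N. (c k l)\<^sup>2)"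
      by (rule prod_sum_PiE[symmetric]) auto
    also have "\<dots> = (\<Prod>k\<in>{1..<m}. 2)"
    proof (rule prod.cong)
      fix k assume k: "k \<in> {1..<m}"
      have "(\<Sum>l<N. (c k l)\<^sup>2) = (\<Sum>l<2. (c k l)\<^sup>2)"
        using N by (intro sum.mono_neutral_right) (auto simp: c_def)
      also have "\<dots> = 2"
        using h[of i k] i k by (simp add: c_def numeral_2_eq_2 N_def)
      finally show "(\<Sum>l<N. (c k l)\<^sup>2) = 2" .
    qed simp
    finally show ?thesis by simp
  qed
  then show ?thesis
    by (simp add: mixed_littlewood_sum_def N_def real_sqrt_power)
qed

lemma mixed_littlewood_lower:
  assumes "2 \<le> m" "mixed_littlewood_constant m C"
  shows "sqrt 2 ^ (m - 1) \<le> C"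
proof -
  have "card ({1..<m} \<rightarrow>\<^sub>E {-1, 1 :: real}) = 2 ^ (m - 1)"
    by (simp add: card_PiE numeral_2_eq_2)
  then obtain h where h: "bij_betw h {..<2 ^ (m - 1) :: nat} ({1..<m} \<rightarrow>\<^sub>E {-1, 1 :: real})"
    using ex_bij_betw_nat_finite[of "{1..<m} \<rightarrow>\<^sub>E {-1, 1 :: real}"]
    by (auto simp: finite_PiE atLeast0LessThan)
  have sq: "(h s k)\<^sup>2 = 1" if "s < 2 ^ (m - 1)" "k \<in> {1..<m}" for s k
    using bij_betwE[OF h] that by (fastforce simp: PiE_iff power2_eq_1_iff)
  let ?U = "extremal_form m h"
  have U: "continuous_multilinear_form m ?U"
    using assms(1) by (intro continuous_multilinear_extremal_form) simp
  have "2 ^ (m - 1) * sqrt 2 ^ (m - 1) = mixed_littlewood_sum m ?U (2 ^ (m - 1))"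
    using mixed_littlewood_sum_extremal_form[OF assms(1) sq] by simp
  also have "\<dots> \<le> C * form_norm m ?U"
    using assms(2) U by (simp add: mixed_littlewood_constant_def)
  finally have le: "2 ^ (m - 1) * sqrt 2 ^ (m - 1) \<le> C * form_norm m ?U" .
  have "0 \<le> form_norm m ?U"
    using abs_le_form_norm[OF U, of "\<lambda>k\<in>{..<m}. 0"] by (auto intro: order_trans[OF abs_ge_zero])
  moreover have "0 < C * form_norm m ?U"
    using le by (rule less_le_trans[rotated]) simp
  ultimately have "0 < C"
    by (simp add: zero_less_mult_iff)
  have "C * form_norm m ?U \<le> C * 2 ^ (m - 1)"
    using form_norm_extremal_form_le[OF _ h] assms(1) \<open>0 < C\<close> by (intro mult_left_mono) simp_all
  with le have "2 ^ (m - 1) * sqrt 2 ^ (m - 1) \<le> C * 2 ^ (m - 1)"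
    by (rule order_trans)
  then show ?thesis by (simp add: mult.commute)
qed

theorem theorem2p1:
  fixes m :: nat
  assumes "m \<ge> 2"
  shows "mixed_littlewood_constant m (sqrt 2 ^ (m - 1)) \<and>
         (\<forall>C. mixed_littlewood_constant m C \<longrightarrow> sqrt 2 ^ (m - 1) \<le> C)"
  using assms mixed_littlewood_upper[of m] mixed_littlewood_lower[of m] by simp

end
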